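(* Let $\mathcal P$ be a tree poset, let $S$ be a maximal antichain of $\mathcal P$, and let $Y(S)=\{Y_1,\dots,Y_m\}$ be the decomposition of $S$ into its maximal collections of siblings. Then every decorated sweep cover colouring $c:S\to\mathcal K$ decomposes uniquely as \[ c=\bigcup_{i=1}^m c_i,\qquad c_i:Y_i\to\mathcal K_i,\qquad \mathcal K_i\cap\mathcal K_j=\emptyset\ \text{ for } i\neq j, \] with $\mathcal K_i\subseteq\mathcal K$.
   Context: A tree poset is a poset with a maximum element (the root) whose Hasse diagram is a rooted tree, with $p\ge q$ iff $p$ lies on the path from the root to $q$. An element $p$ covers $q$ if $q<p$ and there is no $r$ with $q<r<p$; the elements covering $p$ are its parents, the elements covered by $p$ its children, and elements with a common parent are siblings. An antichain is maximal if every element not in it is comparable to some element of it. The sets $Y_1,\dots,Y_m$ are the classes of $S$ in which two distinct elements lie together iff they are siblings; they partition $S$. A decorated sweep cover (DSC) is a colouring $c:S\to\mathcal K$ of a maximal antichain $S$ such that any two distinct $p,q\in S$ with $c(p)=c(q)$ are siblings. The union $\bigcup_i c_i$ means the function on $\bigcup_i Y_i$ restricting to $c_i$ on each $Y_i$. *)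

theory Defs
  imports Main "HOL-Library.FuncSet" "HOL-Library.Disjoint_Sets"
begin

text \<open>
  A poset is a carrier set \<open>P\<close> with a relation \<open>r\<close> such that \<^term>\<open>partial_order_on P r\<close>;
  throughout, \<open>(x, y) \<in> r\<close> means \<open>x \<le> y\<close>.
\<close>

definition strictly_below :: "'a rel \<Rightarrow> 'a \<Rightarrow> 'a \<Rightarrow> bool" where
  "strictly_below r x y \<longleftrightarrow> (x, y) \<in> r \<and> x \<noteq> y"

definition covers :: "'a set \<Rightarrow> 'a rel \<Rightarrow> 'a \<Rightarrow> 'a \<Rightarrow> bool" where
  "covers P r p q \<longleftrightarrow> p \<in> P \<and> q \<in> P \<and> strictly_below r q p \<and>
     \<not> (\<exists>x\<in>P. strictly_below r q x \<and> strictly_below r x p)"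

definition hasse_adj :: "'a set \<Rightarrow> 'a rel \<Rightarrow> 'a \<Rightarrow> 'a \<Rightarrow> bool" where
  "hasse_adj P r p q \<longleftrightarrow> covers P r p q \<or> covers P r q p"

definition is_path :: "'a set \<Rightarrow> ('a \<Rightarrow> 'a \<Rightarrow> bool) \<Rightarrow> 'a \<Rightarrow> 'a list \<Rightarrow> 'a \<Rightarrow> bool" where
  "is_path V adj u xs v \<longleftrightarrow> xs \<noteq> [] \<and> hd xs = u \<and> last xs = v \<and>
     set xs \<subseteq> V \<and> distinct xs \<and> successively adj xs"

text \<open>
  A tree is an undirected graph in which any two vertices are joined by exactly one path.
  The digraph notion of tree in \<open>Graph_Theory\<close> only excludes directed cycles (so the Hasse
  diagram of a diamond, oriented downwards, would count as a tree) and is not suitable here.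
\<close>

definition is_tree :: "'a set \<Rightarrow> ('a \<Rightarrow> 'a \<Rightarrow> bool) \<Rightarrow> bool" where
  "is_tree V adj \<longleftrightarrow> V \<noteq> {} \<and> (\<forall>u\<in>V. \<forall>v\<in>V. \<exists>!xs. is_path V adj u xs v)"

definition tree_poset :: "'a set \<Rightarrow> 'a rel \<Rightarrow> bool" where
  "tree_poset P r \<longleftrightarrow> partial_order_on P r \<and> is_tree P (hasse_adj P r) \<and>
     (\<exists>root\<in>P. (\<forall>q\<in>P. (q, root) \<in> r) \<and>
        (\<forall>p\<in>P. \<forall>q\<in>P. (q, p) \<in> r \<longleftrightarrow>
           (\<exists>xs. is_path P (hasse_adj P r) root xs q \<and> p \<in> set xs)))"

definition siblings :: "'a set \<Rightarrow> 'a rel \<Rightarrow> 'a \<Rightarrow> 'a \<Rightarrow> bool" where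
  "siblings P r p q \<longleftrightarrow> (\<exists>a\<in>P. covers P r a p \<and> covers P r a q)"

definition antichain :: "'a set \<Rightarrow> 'a rel \<Rightarrow> 'a set \<Rightarrow> bool" where
  "antichain P r S \<longleftrightarrow> S \<subseteq> P \<and> (\<forall>p\<in>S. \<forall>q\<in>S. p \<noteq> q \<longrightarrow> (p, q) \<notin> r)"

definition maximal_antichain :: "'a set \<Rightarrow> 'a rel \<Rightarrow> 'a set \<Rightarrow> bool" where
  "maximal_antichain P r S \<longleftrightarrow> antichain P r S \<and>
     (\<forall>x\<in>P - S. \<exists>s\<in>S. (x, s) \<in> r \<or> (s, x) \<in> r)"

text \<open>
  The disjunct \<open>p = q\<close> is needed only for an element without a parent (the root), which
  forms a class of its own.  The relation is an equivalence on \<open>S\<close> because parents are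
  unique in a tree poset.
\<close>

definition sibling_classes :: "'a set \<Rightarrow> 'a rel \<Rightarrow> 'a set \<Rightarrow> 'a set set" where
  "sibling_classes P r S = S // {(p, q). p \<in> S \<and> q \<in> S \<and> (p = q \<or> siblings P r p q)}"

text \<open>
  Functions with a given domain are represented extensionally, so that equality in HOL is
  equality of functions on the domain.
\<close>

definition decorated_sweep_cover ::
    "'a set \<Rightarrow> 'a rel \<Rightarrow> 'a set \<Rightarrow> 'k set \<Rightarrow> ('a \<Rightarrow> 'k) \<Rightarrow> bool" where
  "decorated_sweep_cover P r S K c \<longleftrightarrow> maximal_antichain P r S \<and> c \<in> S \<rightarrow>\<^sub>E K \<and>
     (\<forall>p\<in>S. \<forall>q\<in>S. p \<noteq> q \<and> c p = c q \<longrightarrow> siblings P r p q)"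

text \<open>\<open>c\<close>, a function with domain \<open>S\<close>, is the union of the functions \<open>cs i\<close> with domains \<open>Y i\<close>.\<close>

definition is_fun_union ::
    "'a set \<Rightarrow> 'i set \<Rightarrow> ('i \<Rightarrow> 'a set) \<Rightarrow> ('i \<Rightarrow> 'a \<Rightarrow> 'k) \<Rightarrow> ('a \<Rightarrow> 'k) \<Rightarrow> bool" where
  "is_fun_union S I Y cs c \<longleftrightarrow> S = (\<Union>i\<in>I. Y i) \<and> c \<in> extensional S \<and>
     (\<forall>i\<in>I. restrict c (Y i) = cs i)"

definition colouring_decomposition ::
    "'a set \<Rightarrow> 'k set \<Rightarrow> ('a \<Rightarrow> 'k) \<Rightarrow> 'i set \<Rightarrow> ('i \<Rightarrow> 'a set) \<Rightarrow>
     ('i \<Rightarrow> 'a \<Rightarrow> 'k) \<Rightarrow> ('i \<Rightarrow> 'k set) \<Rightarrow> bool" where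
  "colouring_decomposition S K c I Y cs Ks \<longleftrightarrow>
     Ks \<in> I \<rightarrow>\<^sub>E Pow K \<and> cs \<in> (\<Pi>\<^sub>E i\<in>I. Y i \<rightarrow>\<^sub>E Ks i) \<and>
     disjoint_family_on Ks I \<and> is_fun_union S I Y cs c"

end

theory Submission
  imports Defs
begin

text \<open>
  In a tree poset the elements above \<open>q\<close> are the vertices of the path from the root to \<open>q\<close>, so
  they form a chain and parents are unique.  Hence being siblings is transitive, and the sibling
  classes partition \<open>S\<close>.  A colour used on two classes would belong to two elements that are not
  siblings, so the images of the classes under \<open>c\<close> are disjoint and can serve as the sets of
  colours.  The parts of the decomposition are forced to be the restrictions of \<open>c\<close>.
\<close>

text \<open>Needed to compare two vertices of one root path: cutting the path at a vertex gives a
  path from the root to that vertex, and in a tree poset the order is characterised by such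
  paths.\<close>

lemma is_path_take:
  assumes "is_path V adj u xs v" and "j < length xs"
  shows "is_path V adj u (take (Suc j) xs) (xs ! j)"
proof -
  have "successively adj (take (Suc j) xs @ drop (Suc j) xs)"
    using assms(1) by (simp add: is_path_def)
  then have "successively adj (take (Suc j) xs)"
    unfolding successively_append_iff by blast
  moreover have "last (take (Suc j) xs) = xs ! j"
    using assms(2) by (simp add: take_Suc_conv_app_nth)
  ultimately show ?thesis
    using assms(1) set_take_subset[of "Suc j" xs] by (auto simp: is_path_def)
qed

lemma tree_poset_upper_comparable:
  assumes "tree_poset P r" and "q \<in> P" and "a \<in> P" and "b \<in> P"
    and "(q, a) \<in> r" and "(q, b) \<in> r"
  shows "(a, b) \<in> r \<or> (b, a) \<in> r"
proof -
  obtain root where le_iff: "\<And>p q. \<lbrakk>p \<in> P; q \<in> P\<rbrakk> \<Longrightarrow>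
      (q, p) \<in> r \<longleftrightarrow> (\<exists>xs. is_path P (hasse_adj P r) root xs q \<and> p \<in> set xs)"
    and "root \<in> P"
    using assms(1) unfolding tree_poset_def by blast
  obtain xs where path: "is_path P (hasse_adj P r) root xs q" and "a \<in> set xs"
    using le_iff assms by blast
  \<comment> \<open>The path witnessing that \<open>b\<close> is above \<open>q\<close> must be the
    same list \<open>xs\<close>, so \<open>a\<close> and \<open>b\<close> can be compared by their
    positions in it.\<close>
  moreover have "\<exists>!xs. is_path P (hasse_adj P r) root xs q"
    using assms(1,2) \<open>root \<in> P\<close> unfolding tree_poset_def is_tree_def by blast
  ultimately have "b \<in> set xs"
    using le_iff assms by blast
  \<comment> \<open>Elements descend along the path: its prefix ending at \<open>xs ! j\<close> is a
    path from the root and contains \<open>xs ! i\<close>.\<close>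
  have below: "(xs ! j, xs ! i) \<in> r" if "i \<le> j" "j < length xs" for i j
  proof -
    have "xs ! i = take (Suc j) xs ! i" and "i < length (take (Suc j) xs)"
      using that by auto
    then have "xs ! i \<in> set (take (Suc j) xs)"
      by (metis nth_mem)
    moreover have "set xs \<subseteq> P"
      using path by (simp add: is_path_def)
    ultimately show ?thesis
      using le_iff[of "xs ! i" "xs ! j"] is_path_take[OF path that(2)] that by force
  qed
  obtain i j where "i < length xs" "a = xs ! i" "j < length xs" "b = xs ! j"
    using \<open>a \<in> set xs\<close> \<open>b \<in> set xs\<close> by (metis in_set_conv_nth)
  then show ?thesis
    using below[of i j] below[of j i] by (metis nle_le)
qed

text \<open>Two parents are comparable; if they differed, the lower one would lie strictly between
  \<open>q\<close> and the other, which a cover forbids.\<close>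

lemma tree_poset_parent_unique:
  assumes "tree_poset P r" and "covers P r a q" and "covers P r b q"
  shows "a = b"
  using tree_poset_upper_comparable[OF assms(1), of q a b] assms(2,3)
  unfolding covers_def strictly_below_def by blast

text \<open>Only transitivity depends on the tree: the two parents that the middle element shares
  with its neighbours coincide.\<close>

lemma equiv_siblings:
  assumes "tree_poset P r"
  shows "equiv S {(p, q). p \<in> S \<and> q \<in> S \<and> (p = q \<or> siblings P r p q)}"
proof (rule equivI)
  show "trans {(p, q). p \<in> S \<and> q \<in> S \<and> (p = q \<or> siblings P r p q)}"
    unfolding siblings_def by (rule transI) (use tree_poset_parent_unique[OF assms] in blast)
qed (auto simp: refl_on_def sym_def siblings_def)

lemma Union_sibling_classes:
  assumes "tree_poset P r"
  shows "\<Union> (sibling_classes P r S) = S"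
  unfolding sibling_classes_def by (rule Union_quotient[OF equiv_siblings[OF assms]])

lemma sibling_classes_eq:
  assumes "tree_poset P r" and "A \<in> sibling_classes P r S" and "B \<in> sibling_classes P r S"
    and "p \<in> A" and "q \<in> B" and "p = q \<or> siblings P r p q"
  shows "A = B"
proof -
  have "p \<in> S" "q \<in> S"
    using Union_sibling_classes[OF assms(1), of S] assms(2-5) by auto
  then show ?thesis
    using quotient_eqI[OF equiv_siblings[OF assms(1)], of A S B p q] assms(2-)
    unfolding sibling_classes_def by blast
qed

text \<open>A colour set may be enlarged by colours of \<open>K\<close> that no class uses, so
  uniqueness is split: the parts \<open>cs\<close> are the same for every choice of
  \<open>Ks\<close>, and \<open>Ks\<close> itself is unique once each set is required to be the
  image of its part.\<close>

theorem lemma2: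
  fixes P :: "'a set" and r :: "'a rel" and S :: "'a set"
    and I :: "'i set" and Y :: "'i \<Rightarrow> 'a set"
    and K :: "'k set" and c :: "'a \<Rightarrow> 'k"
  assumes "tree_poset P r"
    and "maximal_antichain P r S"
    and "bij_betw Y I (sibling_classes P r S)"
    and "decorated_sweep_cover P r S K c"
  shows "(\<exists>!cs. \<exists>Ks. colouring_decomposition S K c I Y cs Ks) \<and>
         (\<exists>!(cs, Ks). colouring_decomposition S K c I Y cs Ks \<and> (\<forall>i\<in>I. Ks i = cs i ` Y i))"
proof -
  \<comment> \<open>The images in \<open>Ks\<close> are the smallest admissible colour sets. Both
    families are \<open>undefined\<close> outside \<open>I\<close>, so that they can be unique as
    HOL functions.\<close>
  define cs where "cs = (\<lambda>i\<in>I. restrict c (Y i))"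
  define Ks where "Ks = (\<lambda>i\<in>I. c ` Y i)"
  have S_eq: "S = (\<Union>i\<in>I. Y i)"
    using Union_sibling_classes[OF assms(1), of S] assms(3) by (simp add: bij_betw_def)
  have c: "c \<in> S \<rightarrow>\<^sub>E K"
    and monochromatic: "\<And>p q. \<lbrakk>p \<in> S; q \<in> S; c p = c q\<rbrakk> \<Longrightarrow> p = q \<or> siblings P r p q"
    using assms(4) unfolding decorated_sweep_cover_def by blast+
  have "c ` Y i \<inter> c ` Y j = {}" if "i \<in> I" "j \<in> I" "i \<noteq> j" for i j
  proof (rule ccontr)
    assume "c ` Y i \<inter> c ` Y j \<noteq> {}"
    then obtain p q where pq: "p \<in> Y i" "q \<in> Y j" and "c p = c q"
      by force
    then have "p = q \<or> siblings P r p q"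
      using monochromatic S_eq that by blast
    then have "Y i = Y j"
      by (rule sibling_classes_eq[OF assms(1) bij_betw_apply[OF assms(3) that(1)]
            bij_betw_apply[OF assms(3) that(2)] pq])
    then show False
      using bij_betw_imp_inj_on[OF assms(3)] that by (auto dest: inj_onD)
  qed
  then have "disjoint_family_on Ks I"
    by (simp add: disjoint_family_on_def Ks_def)
  then have decomposition: "colouring_decomposition S K c I Y cs Ks"
    using c S_eq unfolding colouring_decomposition_def is_fun_union_def
    by (auto simp: cs_def Ks_def PiE_iff)
  \<comment> \<open>\<open>is_fun_union\<close> prescribes each part as a restriction of
    \<open>c\<close> without mentioning the colour sets, hence \<open>Ks'\<close> may be arbitrary
    here.\<close>
  have cs_unique: "cs' = cs" if "colouring_decomposition S K c I Y cs' Ks'" for cs' Ks'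
  proof (rule extensionalityI[of _ I])
    show "cs' \<in> extensional I" "cs \<in> extensional I"
      using that by (auto simp: colouring_decomposition_def cs_def PiE_iff)
  qed (use that in \<open>auto simp: colouring_decomposition_def is_fun_union_def cs_def\<close>)
  have Ks_unique: "Ks' = Ks"
    if "colouring_decomposition S K c I Y cs Ks'" "\<forall>i\<in>I. Ks' i = cs i ` Y i" for Ks'
  proof (rule extensionalityI[of _ I])
    show "Ks' \<in> extensional I" "Ks \<in> extensional I"
      using that(1) by (auto simp: colouring_decomposition_def Ks_def PiE_iff)
  qed (use that(2) in \<open>simp add: cs_def Ks_def\<close>)
  have "\<exists>!(cs, Ks). colouring_decomposition S K c I Y cs Ks \<and> (\<forall>i\<in>I. Ks i = cs i ` Y i)"
  proof (rule ex1I[of _ "(cs, Ks)"])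
    show "case (cs, Ks) of (cs, Ks) \<Rightarrow>
        colouring_decomposition S K c I Y cs Ks \<and> (\<forall>i\<in>I. Ks i = cs i ` Y i)"
      using decomposition by (simp add: cs_def Ks_def)
  next
    fix x
    assume "case x of (cs, Ks) \<Rightarrow>
        colouring_decomposition S K c I Y cs Ks \<and> (\<forall>i\<in>I. Ks i = cs i ` Y i)"
    moreover obtain cs' Ks' where x: "x = (cs', Ks')"
      by (rule prod.exhaust)
    ultimately have dec: "colouring_decomposition S K c I Y cs' Ks'"
      and Ks': "\<forall>i\<in>I. Ks' i = cs' i ` Y i"
      by simp_all
    have "cs' = cs"
      by (rule cs_unique[OF dec])
    with dec Ks' have "Ks' = Ks"
      by (intro Ks_unique) simp_all
    with x \<open>cs' = cs\<close> show "x = (cs, Ks)"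
      by simp
  qed
  moreover have "\<exists>!cs. \<exists>Ks. colouring_decomposition S K c I Y cs Ks"
    by (rule ex1I[of _ cs]) (use decomposition in blast, elim exE, rule cs_unique)
  ultimately show ?thesis
    by (intro conjI)
qed

end
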